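(* Let $(G,A_k)$ be a transitive permutation group and let $\widehat G=\wr^{\infty}(G,A_k)$. Let $f\in\widehat G$ be a finite state transformation. Then $f[\widehat G,\widehat G]\in G^{ab}\langle\!\langle t\rangle\!\rangle$ is a rational power series.
   Context: Let $k\ge1$, $A_k=\{0,\dots,k-1\}$ and let $T_k$ be the rooted regular $k$-ary tree, viewed as the Cayley graph of the free monoid $A_k^*$, so that vertices are words over $A_k$, the root is the empty word $\varepsilon$, and each word $u$ is joined to $ua$ for $a\in A_k$. $\mathrm{Aut}(T_k)$ is the group of automorphisms of this rooted tree; it acts on $A_k^*$ preserving length, and is a profinite group (the pointwise stabilizers of the levels $A_k^n$ form a basis of neighbourhoods of the identity). Sections: for $f\in\mathrm{Aut}(T_k)$ and $u\in A_k^*$, the section $f_u\in\mathrm{Aut}(T_k)$ is the unique automorphism with $f(uw)=f(u)f_u(w)$ for all $w\in A_k^*$. Let $\lambda_f\in S_k=\mathrm{Sym}(A_k)$ be the permutation $a\mapsto f(a)$ of $A_k$ induced by $f$. The element $f$ is finite state if $\{f_w\mid w\in A_k^*\}$ is finite. Iterated wreath product: for a transitive permutation group $(G,A_k)$, i.e. $G\le S_k$ transitive on $A_k$, $\widehat G=\wr^\infty(G,A_k)=(G,A_k)\wr(G,A_k)\wr\cdots$ is the closed subgroup of $\mathrm{Aut}(T_k)$ consisting of all $f$ such that $\lambda_{f_w}\in G$ for every $w\in A_k^*$. Abelianization as power series: for a profinite group $H$, $[H,H]$ denotes the closure of the commutator subgroup of $H$, and $H^{ab}=H/[H,H]$. The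 finite abelian group $G^{ab}$ is written additively and viewed as the additive group of a finite commutative ring, via its decomposition as a direct product of cyclic groups $\mathbb Z/p^e\mathbb Z$ of prime power order (each with its usual ring structure, product taken componentwise). $G^{ab}\langle\!\langle t\rangle\!\rangle$ is the ring of formal power series over this ring in one variable $t$, and $\langle s,t^n\rangle$ denotes the coefficient of $t^n$ in $s$. It is known that $\widehat G^{ab}$ is isomorphic to the additive group of $G^{ab}\langle\!\langle t\rangle\!\rangle$, and the two are identified via $$\langle g[\widehat G,\widehat G],t^n\rangle=\sum_{|w|=n}\lambda_{g_w}[G,G]\qquad(n\ge0),$$ the sum being over words $w\in A_k^*$ of length $n$. A power series $s$ over a commutative ring $R$ is rational if $s=p\,q^{-1}$ for some polynomials $p,q\in R[t]$ with $q$ invertible in the ring of formal power series over $R$. *)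

theory Defs
  imports
    "HOL-Algebra.Algebra"
    "HOL-Algebra.UnivPoly"
    "HOL-Number_Theory.Residues"
    "HOL-Analysis.Abstract_Topology"
begin

text \<open>Throughout, \<open>A\<^sub>k = {..<k}\<close>, words are lists over \<open>A\<^sub>k\<close>, and permutations are extensional
  functions as in \<^const>\<open>BijGroup\<close>.\<close>

subsection \<open>Permutation groups and abelianization\<close>

definition perm_group :: "nat \<Rightarrow> (nat \<Rightarrow> nat) set \<Rightarrow> (nat \<Rightarrow> nat) monoid" where
  "perm_group k G = (BijGroup {..<k})\<lparr>carrier := G\<rparr>"

definition transitive_perm_group :: "nat \<Rightarrow> (nat \<Rightarrow> nat) set \<Rightarrow> bool" where
  "transitive_perm_group k G \<longleftrightarrow>
     subgroup G (BijGroup {..<k}) \<and> transitive_action (perm_group k G) {..<k} (\<lambda>g. g)"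

text \<open>\<open>G\<close> is finite and hence discrete, so \<open>[G,G]\<close> needs no closure.\<close>

definition perm_commutator :: "nat \<Rightarrow> (nat \<Rightarrow> nat) set \<Rightarrow> (nat \<Rightarrow> nat) set" where
  "perm_commutator k G = derived (perm_group k G) G"

definition perm_ab :: "nat \<Rightarrow> (nat \<Rightarrow> nat) set \<Rightarrow> (nat \<Rightarrow> nat) set monoid" where
  "perm_ab k G = perm_group k G Mod perm_commutator k G"

text \<open>\<open>R\<close> is a ring with additive group \<open>A\<close>, obtained from a decomposition of \<open>A\<close> as a
  direct product of cyclic groups of prime power order (the empty product being the zero ring).
  Such a decomposition is not unique; every choice is admitted.\<close>

definition cyclic_product_ring_on :: "'a monoid \<Rightarrow> 'a ring \<Rightarrow> bool" where
  "cyclic_product_ring_on A R \<longleftrightarrow>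
     cring R \<and> add_monoid R = A \<and>
     (\<exists>ms. (\<forall>m \<in> set ms. \<exists>p e :: nat. Factorial_Ring.prime p \<and> 0 < e \<and> m = int (p ^ e)) \<and>
           R \<simeq> RDirProd_list (map residue_ring ms))"

subsection \<open>The rooted tree and its automorphisms\<close>

definition tree_words :: "nat \<Rightarrow> nat list set" where
  "tree_words k = lists {..<k}"

definition tree_adj :: "nat \<Rightarrow> nat list \<Rightarrow> nat list \<Rightarrow> bool" where
  "tree_adj k u v \<longleftrightarrow> (\<exists>a < k. v = u @ [a] \<or> u = v @ [a])"

definition tree_auts :: "nat \<Rightarrow> (nat list \<Rightarrow> nat list) set" where
  "tree_auts k = {f \<in> Bij (tree_words k). f [] = [] \<and>
     (\<forall>u \<in> tree_words k. \<forall>v \<in> tree_words k. tree_adj k (f u) (f v) \<longleftrightarrow> tree_adj k u v)}"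

definition tree_aut_group :: "nat \<Rightarrow> (nat list \<Rightarrow> nat list) monoid" where
  "tree_aut_group k = (BijGroup (tree_words k))\<lparr>carrier := tree_auts k\<rparr>"

definition level_stabilizer :: "nat \<Rightarrow> nat \<Rightarrow> (nat list \<Rightarrow> nat list) set" where
  "level_stabilizer k n = {f \<in> tree_auts k. \<forall>w \<in> tree_words k. length w = n \<longrightarrow> f w = w}"

definition tree_aut_topology :: "nat \<Rightarrow> (nat list \<Rightarrow> nat list) topology" where
  "tree_aut_topology k = topology_generated_by
     {f <#\<^bsub>tree_aut_group k\<^esub> level_stabilizer k n | f n. f \<in> tree_auts k}"

definition tree_section :: "nat \<Rightarrow> (nat list \<Rightarrow> nat list) \<Rightarrow> nat list \<Rightarrow> (nat list \<Rightarrow> nat list)" where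
  "tree_section k f u =
     (THE g. g \<in> tree_auts k \<and> (\<forall>w \<in> tree_words k. f (u @ w) = f u @ g w))"

text \<open>An automorphism sends one-letter words to one-letter words, so \<open>hd\<close> reads off the letter.\<close>

definition root_perm :: "nat \<Rightarrow> (nat list \<Rightarrow> nat list) \<Rightarrow> (nat \<Rightarrow> nat)" where
  "root_perm k f = (\<lambda>a \<in> {..<k}. hd (f [a]))"

definition finite_state :: "nat \<Rightarrow> (nat list \<Rightarrow> nat list) \<Rightarrow> bool" where
  "finite_state k f \<longleftrightarrow> finite {tree_section k f w | w. w \<in> tree_words k}"

subsection \<open>The iterated wreath product and its abelianization\<close>

definition iterated_wreath :: "nat \<Rightarrow> (nat \<Rightarrow> nat) set \<Rightarrow> (nat list \<Rightarrow> nat list) set" where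
  "iterated_wreath k G =
     {f \<in> tree_auts k. \<forall>w \<in> tree_words k. root_perm k (tree_section k f w) \<in> G}"

definition wreath_group :: "nat \<Rightarrow> (nat \<Rightarrow> nat) set \<Rightarrow> (nat list \<Rightarrow> nat list) monoid" where
  "wreath_group k G = (tree_aut_group k)\<lparr>carrier := iterated_wreath k G\<rparr>"

definition wreath_commutator :: "nat \<Rightarrow> (nat \<Rightarrow> nat) set \<Rightarrow> (nat list \<Rightarrow> nat list) set" where
  "wreath_commutator k G =
     subtopology (tree_aut_topology k) (iterated_wreath k G) closure_of
       derived (wreath_group k G) (iterated_wreath k G)"

definition wreath_ab :: "nat \<Rightarrow> (nat \<Rightarrow> nat) set \<Rightarrow> (nat list \<Rightarrow> nat list) set monoid" where
  "wreath_ab k G = wreath_group k G Mod wreath_commutator k G"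

definition wreath_class ::
    "nat \<Rightarrow> (nat \<Rightarrow> nat) set \<Rightarrow> (nat list \<Rightarrow> nat list) \<Rightarrow> (nat list \<Rightarrow> nat list) set" where
  "wreath_class k G f = wreath_commutator k G #>\<^bsub>wreath_group k G\<^esub> f"

lemma wreath_class_in_ab:
  "f \<in> iterated_wreath k G \<Longrightarrow> wreath_class k G f \<in> carrier (wreath_ab k G)"
  by (auto simp: wreath_class_def wreath_ab_def wreath_group_def FactGroup_def RCOSETS_def)

subsection \<open>Formal power series over a ring\<close>

text \<open>The operations are those of \<^const>\<open>UP\<close>, without the finite support condition; thus the
  polynomials among the series are exactly the elements of \<^const>\<open>up\<close>.\<close>

definition power_series_ring :: "('a, 'm) ring_scheme \<Rightarrow> (nat \<Rightarrow> 'a) ring" where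
  "power_series_ring R = \<lparr>
     carrier = UNIV \<rightarrow> carrier R,
     monoid.mult = (\<lambda>p q n. \<Oplus>\<^bsub>R\<^esub>i \<in> {..n}. p i \<otimes>\<^bsub>R\<^esub> q (n - i)),
     one = (\<lambda>n. if n = 0 then \<one>\<^bsub>R\<^esub> else \<zero>\<^bsub>R\<^esub>),
     ring.zero = (\<lambda>n. \<zero>\<^bsub>R\<^esub>),
     ring.add = (\<lambda>p q n. p n \<oplus>\<^bsub>R\<^esub> q n)\<rparr>"

definition rational_series :: "('a, 'm) ring_scheme \<Rightarrow> (nat \<Rightarrow> 'a) \<Rightarrow> bool" where
  "rational_series R s \<longleftrightarrow>
     s \<in> carrier (power_series_ring R) \<and>
     (\<exists>p \<in> up R. \<exists>q \<in> up R. q \<in> Units (power_series_ring R) \<and>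
        s = p \<otimes>\<^bsub>power_series_ring R\<^esub> inv\<^bsub>power_series_ring R\<^esub> q)"

definition portrait_series ::
    "nat \<Rightarrow> (nat \<Rightarrow> nat) set \<Rightarrow> (nat \<Rightarrow> nat) set ring \<Rightarrow> (nat list \<Rightarrow> nat list) \<Rightarrow>
      nat \<Rightarrow> (nat \<Rightarrow> nat) set" where
  "portrait_series k G R g n =
     (\<Oplus>\<^bsub>R\<^esub>w \<in> {w \<in> tree_words k. length w = n}.
        perm_commutator k G #>\<^bsub>perm_group k G\<^esub> root_perm k (tree_section k g w))"

text \<open>The identification of the abelianization of the wreath product with power series. The
  series depends only on the class \<open>C\<close>, so all representatives in \<open>C\<close> give the same value.\<close>

definition ab_series ::
    "nat \<Rightarrow> (nat \<Rightarrow> nat) set \<Rightarrow> (nat \<Rightarrow> nat) set ring \<Rightarrow> (nat list \<Rightarrow> nat list) set \<Rightarrow>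
      nat \<Rightarrow> (nat \<Rightarrow> nat) set" where
  "ab_series k G R C = the_elem (portrait_series k G R ` C)"

end

theory Submission
  imports Defs
begin

text \<open>The portrait series is a homomorphism on the wreath product whose \<open>n\<close>-th coefficient depends only
  on the action on words of length \<open>n + 1\<close>; hence it vanishes on the closed commutator subgroup and is
  constant on classes. If \<open>f\<close> is finite state, the \<open>n\<close>-th coefficients at all sections of \<open>f\<close> form a
  vector over a finite ring, and the vector at \<open>n\<close> determines the one at \<open>n + 1\<close>. So the series of \<open>f\<close>
  is ultimately periodic, and multiplying it by \<open>1 - t\<^sup>P\<close> gives a polynomial.\<close>

subsection \<open>Ultimately periodic power series\<close>

lemma power_series_simps:
  "carrier (power_series_ring R) = UNIV \<rightarrow> carrier R"
  "p \<otimes>\<^bsub>power_series_ring R\<^esub> q = (\<lambda>n. \<Oplus>\<^bsub>R\<^esub>i \<in> {..n}. p i \<otimes>\<^bsub>R\<^esub> q (n - i))"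
  "\<one>\<^bsub>power_series_ring R\<^esub> = (\<lambda>n. if n = 0 then \<one>\<^bsub>R\<^esub> else \<zero>\<^bsub>R\<^esub>)"
  by (simp_all add: power_series_ring_def)

context cring
begin

text \<open>Associativity is the case \<open>k = n\<close>. Cutting the outer sum at
  \<open>k\<close> while keeping \<open>n\<close> fixed makes induction possible: passing to
  \<open>k + 1\<close> adds exactly the terms with factor \<open>c (n - Suc k)\<close> on both
  sides.\<close>

lemma power_series_mult_assoc:
  fixes a b c :: "nat \<Rightarrow> 'a"
  assumes "a \<in> UNIV \<rightarrow> carrier R" "b \<in> UNIV \<rightarrow> carrier R" "c \<in> UNIV \<rightarrow> carrier R" "k \<le> n"
  shows "(\<Oplus>j \<in> {..k}. (\<Oplus>i \<in> {..j}. a i \<otimes> b (j - i)) \<otimes> c (n - j)) =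
         (\<Oplus>j \<in> {..k}. a j \<otimes> (\<Oplus>i \<in> {..k - j}. b i \<otimes> c (n - j - i)))"
  using \<open>k \<le> n\<close>
proof (induction k)
  case 0
  then show ?case using assms by (simp add: Pi_def m_assoc)
next
  case (Suc k)
  then have "k \<le> n" by simp
  note IH = Suc.IH[OF this]
  show ?case
    using assms(1-3) IH Suc.prems
    by (simp cong: finsum_cong add: Suc_diff_le Pi_def l_distr r_distr m_assoc)
       (simp cong: finsum_cong add: Pi_def a_ac finsum_ldistr m_assoc)
qed

text \<open>The reflection \<open>i \<mapsto> n - i\<close> permutes \<open>{..n}\<close> and
  exchanges the two indices of the convolution.\<close>

lemma power_series_mult_comm:
  fixes a b :: "nat \<Rightarrow> 'a"
  assumes "a \<in> UNIV \<rightarrow> carrier R" "b \<in> UNIV \<rightarrow> carrier R"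
  shows "(\<Oplus>i \<in> {..n}. a i \<otimes> b (n - i)) = (\<Oplus>i \<in> {..n}. b i \<otimes> a (n - i))"
proof -
  have inj: "inj_on (\<lambda>i. n - i) {..n}"
    by (auto intro: inj_onI)
  have img: "(\<lambda>i. n - i) ` {..n} = {..n}"
    by (auto simp: image_iff) (metis atMost_iff diff_diff_cancel diff_le_self)
  have "(\<Oplus>i \<in> {..n}. a i \<otimes> b (n - i)) = (\<Oplus>i \<in> (\<lambda>i. n - i) ` {..n}. a i \<otimes> b (n - i))"
    by (simp only: img)
  also have "\<dots> = (\<Oplus>i \<in> {..n}. a (n - i) \<otimes> b (n - (n - i)))"
    using assms inj by (subst finsum_reindex) auto
  also have "\<dots> = (\<Oplus>i \<in> {..n}. b i \<otimes> a (n - i))"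
    using assms by (intro finsum_cong') (auto simp: m_comm Pi_iff)
  finally show ?thesis .
qed

lemma finsum_delta:
  assumes "finite A" "i \<in> A" "x \<in> carrier R"
  shows "(\<Oplus>j \<in> A. if j = i then x else \<zero>) = x"
  using add.finprod_singleton[OF assms(2,1), of "\<lambda>_. x"] assms(3)
  by (simp add: eq_commute[of i])

text \<open>Units, inverses and hence rationality are expressed through multiplication; this gives
  access to the general facts about inverses in a commutative monoid.\<close>

lemma power_series_comm_monoid: "comm_monoid (power_series_ring R)"
proof (rule comm_monoidI)
  fix a b c
  assume a: "a \<in> carrier (power_series_ring R)"
    and b: "b \<in> carrier (power_series_ring R)"
    and c: "c \<in> carrier (power_series_ring R)"
  show "a \<otimes>\<^bsub>power_series_ring R\<^esub> b \<in> carrier (power_series_ring R)"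
    using a b by (auto simp: power_series_simps Pi_iff intro!: finsum_closed)
  show "a \<otimes>\<^bsub>power_series_ring R\<^esub> b \<otimes>\<^bsub>power_series_ring R\<^esub> c =
        a \<otimes>\<^bsub>power_series_ring R\<^esub> (b \<otimes>\<^bsub>power_series_ring R\<^esub> c)"
    using power_series_mult_assoc[of a b c] a b c by (auto simp: power_series_simps)
  show "a \<otimes>\<^bsub>power_series_ring R\<^esub> b = b \<otimes>\<^bsub>power_series_ring R\<^esub> a"
    using power_series_mult_comm[of a b] a b by (auto simp: power_series_simps)
next
  fix a
  assume a: "a \<in> carrier (power_series_ring R)"
  have "(\<Oplus>i \<in> {..n}. (if i = 0 then \<one> else \<zero>) \<otimes> a (n - i)) = a n" for n
  proof -
    have "(\<Oplus>i \<in> {..n}. (if i = 0 then \<one> else \<zero>) \<otimes> a (n - i)) =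
          (\<Oplus>i \<in> {..n}. if i = 0 then a n else \<zero>)"
      using a by (intro finsum_cong') (auto simp: power_series_simps Pi_iff)
    also have "\<dots> = a n"
      using a by (intro finsum_delta) (auto simp: power_series_simps)
    finally show ?thesis .
  qed
  then show "\<one>\<^bsub>power_series_ring R\<^esub> \<otimes>\<^bsub>power_series_ring R\<^esub> a = a"
    by (simp add: power_series_simps)
qed (auto simp: power_series_simps)

text \<open>The left factor is \<open>1 - t^P\<close>, so the product is the series minus its shift
  by \<open>P\<close>.\<close>

lemma one_minus_monomial_mult:
  fixes x :: "nat \<Rightarrow> 'a"
  assumes "x \<in> UNIV \<rightarrow> carrier R" "0 < P"
  shows "(\<Oplus>i \<in> {..n}. (if i = 0 then \<one> else if i = P then \<ominus> \<one> else \<zero>) \<otimes> x (n - i)) =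
         (if n < P then x n else x n \<ominus> x (n - P))"
proof -
  have x: "x i \<in> carrier R" for i
    using assms(1) by auto
  \<comment> \<open>Since \<open>P > 0\<close>, the cases \<open>i = 0\<close> and
    \<open>i = P\<close> exclude each other, and the summand splits into two delta terms.\<close>
  have "(\<Oplus>i \<in> {..n}. (if i = 0 then \<one> else if i = P then \<ominus> \<one> else \<zero>) \<otimes> x (n - i)) =
        (\<Oplus>i \<in> {..n}. (if i = 0 then x n else \<zero>) \<oplus> (if i = P then \<ominus> x (n - P) else \<zero>))"
    using assms(2) x by (intro finsum_cong') (auto simp: l_minus)
  also have "\<dots> = (\<Oplus>i \<in> {..n}. if i = 0 then x n else \<zero>) \<oplus>
                   (\<Oplus>i \<in> {..n}. if i = P then \<ominus> x (n - P) else \<zero>)"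
    using x by (intro finsum_addf) auto
  also have "(\<Oplus>i \<in> {..n}. if i = 0 then x n else \<zero>) = x n"
    using x by (intro finsum_delta) auto
  also have "(\<Oplus>i \<in> {..n}. if i = P then \<ominus> x (n - P) else \<zero>) =
             (if n < P then \<zero> else \<ominus> x (n - P))"
  proof (cases "n < P")
    case True
    then have "(\<Oplus>i \<in> {..n}. if i = P then \<ominus> x (n - P) else \<zero>) = (\<Oplus>i \<in> {..n}. \<zero>)"
      by (intro finsum_cong') auto
    with True show ?thesis by simp
  next
    case False
    then show ?thesis using x by (simp add: finsum_delta)
  qed
  finally show ?thesis
    using x by (simp add: minus_eq)
qed

lemma ultimately_periodic_imp_rational:
  assumes s: "s \<in> UNIV \<rightarrow> carrier R" and P: "0 < P"
    and per: "\<And>n. N \<le> n \<Longrightarrow> s (n + P) = s n"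
  shows "rational_series R s"
proof -
  interpret PS: comm_monoid "power_series_ring R"
    by (rule power_series_comm_monoid)
  \<comment> \<open>The denominator \<open>1 - t^P\<close> and, as \<open>r\<close>, its inverse,
    the geometric series in \<open>t^P\<close>.\<close>
  define q where "q = (\<lambda>i. if i = 0 then \<one> else if i = P then \<ominus> \<one> else \<zero>)"
  define r where "r = (\<lambda>n. if P dvd n then \<one> else \<zero>)"
  define p where "p = q \<otimes>\<^bsub>power_series_ring R\<^esub> s"
  have q: "q \<in> carrier (power_series_ring R)" and r: "r \<in> carrier (power_series_ring R)"
    and s': "s \<in> carrier (power_series_ring R)"
    using s by (auto simp: q_def r_def power_series_simps)
  have q_mult: "(q \<otimes>\<^bsub>power_series_ring R\<^esub> x) n = (if n < P then x n else x n \<ominus> x (n - P))"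
    if "x \<in> carrier (power_series_ring R)" for x n
    using one_minus_monomial_mult[of x P n] that P by (simp add: q_def power_series_simps)
  have "q \<otimes>\<^bsub>power_series_ring R\<^esub> r = \<one>\<^bsub>power_series_ring R\<^esub>"
  proof
    fix n
    have "(q \<otimes>\<^bsub>power_series_ring R\<^esub> r) n = (if n = 0 then \<one> else \<zero>)"
    proof (cases "n < P")
      case True
      then show ?thesis
        using r P by (auto simp: q_mult r_def dest: dvd_imp_le)
    next
      case False
      \<comment> \<open>Beyond degree \<open>P\<close> the coefficients of \<open>r\<close> at
        \<open>n\<close> and \<open>n - P\<close> agree and cancel; below \<open>P\<close> only the
        constant term of \<open>r\<close> is nonzero.\<close>
      then have "P dvd n - P \<longleftrightarrow> P dvd n" "n \<noteq> 0"
        using P by (auto simp: dvd_minus_self)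
      with False show ?thesis
        using r by (auto simp: q_mult r_def r_right_minus_eq)
    qed
    then show "(q \<otimes>\<^bsub>power_series_ring R\<^esub> r) n = \<one>\<^bsub>power_series_ring R\<^esub> n"
      by (simp add: power_series_simps)
  qed
  then have q_unit: "q \<in> Units (power_series_ring R)"
    using q r PS.m_comm[OF q r] by (auto simp: Units_def intro!: bexI[of _ r])
  \<comment> \<open>In degrees above \<open>N + P\<close> the index \<open>n - P\<close> already
    lies in the periodic range, so \<open>p n = s n - s (n - P)\<close> vanishes and
    \<open>p\<close> is a polynomial.\<close>
  have "bound \<zero> (N + P) p"
  proof
    fix n
    assume n: "N + P < n"
    then have "s n = s (n - P)"
      using per[of "n - P"] by simp
    then show "p n = \<zero>"
      using n s s' by (simp add: p_def q_mult Pi_iff r_right_minus_eq)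
  qed
  moreover have p: "p \<in> carrier (power_series_ring R)"
    using q s' by (simp add: p_def)
  ultimately have "p \<in> up R"
    by (auto simp: up_def power_series_simps)
  moreover have "q \<in> up R"
    using q by (auto simp: up_def q_def power_series_simps bound_def intro!: exI[of _ P])
  moreover have "s = p \<otimes>\<^bsub>power_series_ring R\<^esub> inv\<^bsub>power_series_ring R\<^esub> q"
  proof -
    have "p = s \<otimes>\<^bsub>power_series_ring R\<^esub> q"
      using PS.m_comm[OF q s'] by (simp add: p_def)
    then show ?thesis
      using q s' q_unit by (simp add: PS.m_assoc)
  qed
  ultimately show ?thesis
    using s' q_unit by (auto simp: rational_series_def)
qed

end

subsection \<open>Sections of tree automorphisms\<close>

lemma append_in_tree_words [simp]:
  "u @ v \<in> tree_words k \<longleftrightarrow> u \<in> tree_words k \<and> v \<in> tree_words k"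
  by (auto simp: tree_words_def)

lemma Cons_in_tree_words [simp]: "a # u \<in> tree_words k \<longleftrightarrow> a < k \<and> u \<in> tree_words k"
  by (auto simp: tree_words_def)

lemma Nil_in_tree_words [simp]: "[] \<in> tree_words k"
  by (auto simp: tree_words_def)

lemma finite_tree_level [simp]: "finite {w \<in> tree_words k. length w = n}"
proof -
  have "{w \<in> tree_words k. length w = n} = {w. set w \<subseteq> {..<k} \<and> length w = n}"
    by (auto simp: tree_words_def)
  then show ?thesis
    by (simp add: finite_lists_length_eq)
qed

lemma tree_adj_append [simp]: "tree_adj k (u @ v) (u @ w) \<longleftrightarrow> tree_adj k v w"
  by (simp add: tree_adj_def)

lemma tree_autsD:
  assumes "f \<in> tree_auts k"
  shows "f \<in> Bij (tree_words k)" "f [] = []"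
    "bij_betw f (tree_words k) (tree_words k)" "f \<in> extensional (tree_words k)"
    "\<And>u. u \<in> tree_words k \<Longrightarrow> f u \<in> tree_words k"
    "\<And>u v. u \<in> tree_words k \<Longrightarrow> v \<in> tree_words k \<Longrightarrow> f u = f v \<longleftrightarrow> u = v"
    "\<And>u v. u \<in> tree_words k \<Longrightarrow> v \<in> tree_words k \<Longrightarrow> tree_adj k (f u) (f v) \<longleftrightarrow> tree_adj k u v"
  using assms by (auto simp: tree_auts_def Bij_def bij_betw_def dest: inj_onD)

text \<open>\<open>tree_adj\<close> is symmetric, so that children go to children has to be derived.
  It starts at the fixed root, which has only children as neighbours, and spreads down the tree by
  injectivity.\<close>

lemma tree_auts_snoc:
  assumes f: "f \<in> tree_auts k"
  shows "u \<in> tree_words k \<Longrightarrow> a < k \<Longrightarrow> \<exists>b<k. f (u @ [a]) = f u @ [b]"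
proof (induction u arbitrary: a rule: rev_induct)
  case Nil
  then have "tree_adj k (f []) (f [a])"
    using f by (subst tree_autsD(7)[OF f]) (auto simp: tree_adj_def)
  then show ?case
    using tree_autsD(2)[OF f] by (auto simp: tree_adj_def)
next
  case (snoc c u)
  then obtain d where d: "d < k" "f (u @ [c]) = f u @ [d]"
    by auto
  have "tree_adj k (f (u @ [c])) (f ((u @ [c]) @ [a]))"
    using snoc.prems by (subst tree_autsD(7)[OF f]) (auto simp: tree_adj_def)
  then obtain b where "b < k"
    and b: "f ((u @ [c]) @ [a]) = f (u @ [c]) @ [b] \<or> f (u @ [c]) = f ((u @ [c]) @ [a]) @ [b]"
    by (auto simp: tree_adj_def)
  \<comment> \<open>In the second alternative the image would be the parent of
    \<open>f (u @ [c])\<close>, which is \<open>f u\<close> by the induction hypothesis; injectivity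
    excludes this.\<close>
  moreover have "f ((u @ [c]) @ [a]) \<noteq> f u"
    using snoc.prems by (subst tree_autsD(6)[OF f]) auto
  ultimately show ?case
    using d by auto
qed

text \<open>Iterating the one-letter case: prefixes and lengths are preserved, which is what makes
  sections exist.\<close>

lemma tree_auts_append:
  assumes f: "f \<in> tree_auts k" and u: "u \<in> tree_words k"
  shows "v \<in> tree_words k \<Longrightarrow> \<exists>w \<in> tree_words k. length w = length v \<and> f (u @ v) = f u @ w"
proof (induction v rule: rev_induct)
  case Nil
  then show ?case by auto
next
  case (snoc a v)
  then obtain w where w: "w \<in> tree_words k" "length w = length v" "f (u @ v) = f u @ w"
    by auto
  obtain b where "b < k" "f ((u @ v) @ [a]) = f (u @ v) @ [b]"
    using tree_auts_snoc[OF f, of "u @ v" a] u snoc.prems by auto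
  then show ?case
    using w by (auto intro!: bexI[of _ "w @ [b]"])
qed

lemma tree_auts_length:
  assumes "f \<in> tree_auts k" "u \<in> tree_words k"
  shows "length (f u) = length u"
  using tree_auts_append[OF assms(1), of "[]" u] assms(2) tree_autsD(2)[OF assms(1)] by auto

text \<open>Cancelling the prefix \<open>f u\<close> determines a section on all words, and
  extensionality fixes it elsewhere, so the definite description is met by any candidate. Sections
  below are computed by exhibiting one.\<close>

lemma tree_section_eqI:
  assumes g: "g \<in> tree_auts k" and eq: "\<And>w. w \<in> tree_words k \<Longrightarrow> f (u @ w) = f u @ g w"
  shows "tree_section k f u = g"
  unfolding tree_section_def
proof (rule the_equality)
  fix g'
  assume g': "g' \<in> tree_auts k \<and> (\<forall>w \<in> tree_words k. f (u @ w) = f u @ g' w)"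
  show "g' = g"
  proof (rule extensionalityI)
    show "g' \<in> extensional (tree_words k)" "g \<in> extensional (tree_words k)"
      using g g' tree_autsD(4) by auto
    show "g' w = g w" if "w \<in> tree_words k" for w
      using eq[OF that] g' that by auto
  qed
qed (use assms in auto)

text \<open>Existence of sections: the candidate strips the prefix \<open>f u\<close> from
  \<open>f (u @ w)\<close>. Injectivity and preservation of adjacency are inherited from
  \<open>f\<close>; surjectivity takes an argument with prefixes.\<close>

lemma tree_section:
  assumes f: "f \<in> tree_auts k" and u: "u \<in> tree_words k"
  shows tree_section_in_tree_auts: "tree_section k f u \<in> tree_auts k" (is ?in)
    and tree_section_append: "w \<in> tree_words k \<Longrightarrow> f (u @ w) = f u @ tree_section k f u w"
proof -
  define g where "g = (\<lambda>w \<in> tree_words k. drop (length u) (f (u @ w)))"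
  have eq: "f (u @ w) = f u @ g w" and g_in: "g w \<in> tree_words k" if "w \<in> tree_words k" for w
    using tree_auts_append[OF f u that] that tree_auts_length[OF f u] by (auto simp: g_def)
  have "\<exists>w \<in> tree_words k. g w = v" if v: "v \<in> tree_words k" for v
  proof -
    have "f u @ v \<in> tree_words k"
      using v u tree_autsD(5)[OF f] by auto
    then obtain x where x: "x \<in> tree_words k" "f x = f u @ v"
      using tree_autsD(3)[OF f] by (metis bij_betw_def imageE)
    \<comment> \<open>The preimage \<open>x\<close> of \<open>f u @ v\<close> is cut at the length
      of \<open>u\<close>; the aim is to show that its first part is \<open>u\<close>.\<close>
    define y where "y = take (length u) x"
    define z where "z = drop (length u) x"
    have yz: "x = y @ z" "y \<in> tree_words k" "z \<in> tree_words k"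
      using x(1) by (auto simp: y_def z_def tree_words_def dest: in_set_takeD in_set_dropD)
    have "length x = length u + length v"
      using tree_auts_length[OF f x(1)] tree_auts_length[OF f u] x(2) by simp
    then have "length y = length u"
      by (simp add: y_def)
    moreover obtain w where "f x = f y @ w"
      using tree_auts_append[OF f yz(2,3)] yz(1) by auto
    \<comment> \<open>Both \<open>f y\<close> and \<open>f u\<close> are prefixes of
      \<open>f x\<close>, and they have the same length.\<close>
    ultimately have "f y = f u"
      using x(2) tree_auts_length[OF f u] tree_auts_length[OF f yz(2)] by auto
    then have "x = u @ z"
      using tree_autsD(6)[OF f yz(2) u] yz(1) by simp
    then show ?thesis
      using x(2) eq[OF yz(3)] yz(3) by auto
  qed
  moreover have "inj_on g (tree_words k)"
  proof (rule inj_onI)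
    fix v w
    assume "v \<in> tree_words k" "w \<in> tree_words k" "g v = g w"
    then show "v = w"
      using tree_autsD(6)[OF f, of "u @ v" "u @ w"] eq u by auto
  qed
  ultimately have "bij_betw g (tree_words k) (tree_words k)"
    using g_in by (auto simp: bij_betw_def)
  moreover have "tree_adj k (g v) (g w) \<longleftrightarrow> tree_adj k v w"
    if "v \<in> tree_words k" "w \<in> tree_words k" for v w
    using tree_autsD(7)[OF f, of "u @ v" "u @ w"] eq u that by auto
  moreover have "g [] = []"
    using eq[of "[]"] by simp
  ultimately have "g \<in> tree_auts k"
    by (simp add: tree_auts_def Bij_def g_def)
  moreover from this have "tree_section k f u = g"
    using eq by (rule tree_section_eqI)
  ultimately show ?in "w \<in> tree_words k \<Longrightarrow> f (u @ w) = f u @ tree_section k f u w"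
    using eq by auto
qed

lemma tree_section_Nil:
  assumes "f \<in> tree_auts k"
  shows "tree_section k f [] = f"
  using assms tree_autsD(2)[OF assms] by (intro tree_section_eqI) auto

text \<open>The rule \<open>(f_u)_v = f_(uv)\<close>; it makes the set of states of \<open>f\<close>
  closed under taking sections.\<close>

lemma tree_section_section:
  assumes f: "f \<in> tree_auts k" and u: "u \<in> tree_words k" and v: "v \<in> tree_words k"
  shows "tree_section k (tree_section k f u) v = tree_section k f (u @ v)"
proof (rule sym, rule tree_section_eqI)
  note s = tree_section_in_tree_auts[OF f u]
  show "tree_section k (tree_section k f u) v \<in> tree_auts k"
    by (rule tree_section_in_tree_auts[OF s v])
  show "f ((u @ v) @ w) = f (u @ v) @ tree_section k (tree_section k f u) v w"
    if "w \<in> tree_words k" for w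
    using tree_section_append[OF f u, of "v @ w"] tree_section_append[OF f u v]
      tree_section_append[OF s v that] v that by simp
qed

section \<open>Identity, composition and inverses of tree automorphisms, and their sections\<close>

lemma id_in_tree_auts: "(\<lambda>w \<in> tree_words k. w) \<in> tree_auts k"
  by (auto simp: tree_auts_def id_Bij)

lemma compose_in_tree_auts:
  assumes "f \<in> tree_auts k" "g \<in> tree_auts k"
  shows "compose (tree_words k) f g \<in> tree_auts k"
  using tree_autsD[OF assms(1)] tree_autsD[OF assms(2)]
  by (simp add: tree_auts_def compose_Bij) (simp add: compose_def)

lemma inv_in_tree_auts:
  assumes f: "f \<in> tree_auts k"
  shows "(\<lambda>w \<in> tree_words k. inv_into (tree_words k) f w) \<in> tree_auts k" (is "?g \<in> _")
proof -
  have bij: "?g \<in> Bij (tree_words k)"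
    using tree_autsD(1)[OF f] by (rule restrict_inv_into_Bij)
  have fg: "f (?g w) = w" "?g w \<in> tree_words k" if "w \<in> tree_words k" for w
    using tree_autsD(3)[OF f] that
    by (auto simp: bij_betw_inv_into_right bij_betw_def inv_into_into)
  have "?g [] = []"
    using tree_autsD(2)[OF f] tree_autsD(6)[OF f, of "?g []" "[]"] fg[of "[]"] by auto
  moreover have "tree_adj k (?g u) (?g v) \<longleftrightarrow> tree_adj k u v"
    if "u \<in> tree_words k" "v \<in> tree_words k" for u v
    using tree_autsD(7)[OF f, of "?g u" "?g v"] fg[OF that(1)] fg[OF that(2)] by simp
  ultimately show ?thesis
    using bij by (auto simp: tree_auts_def)
qed

lemma tree_section_id:
  "u \<in> tree_words k \<Longrightarrow> tree_section k (\<lambda>w \<in> tree_words k. w) u = (\<lambda>w \<in> tree_words k. w)"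
  by (rule tree_section_eqI) (auto simp: id_in_tree_auts)

text \<open>The prefix \<open>u\<close> is first moved to \<open>g u\<close>, so the outer section
  is taken there: \<open>(f g)_u = f_(g u) g_u\<close>.\<close>

lemma tree_section_compose:
  assumes f: "f \<in> tree_auts k" and g: "g \<in> tree_auts k" and u: "u \<in> tree_words k"
  shows "tree_section k (compose (tree_words k) f g) u =
         compose (tree_words k) (tree_section k f (g u)) (tree_section k g u)"
proof (rule tree_section_eqI)
  have gu: "g u \<in> tree_words k"
    using g u by (rule tree_autsD(5))
  show "compose (tree_words k) (tree_section k f (g u)) (tree_section k g u) \<in> tree_auts k"
    by (intro compose_in_tree_auts tree_section_in_tree_auts f g u gu)
  show "compose (tree_words k) f g (u @ w) = compose (tree_words k) f g u @
      compose (tree_words k) (tree_section k f (g u)) (tree_section k g u) w"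
    if w: "w \<in> tree_words k" for w
    using tree_section_append[OF g u w] u w
      tree_section_append[OF f gu tree_autsD(5)[OF tree_section_in_tree_auts[OF g u] w]]
    by (simp add: compose_def)
qed

section \<open>Root permutations\<close>

lemma root_perm_singleton:
  assumes "f \<in> tree_auts k" "a < k"
  shows "f [a] = [root_perm k f a]" "root_perm k f a < k"
  using tree_auts_snoc[OF assms(1) _ assms(2), of "[]"] tree_autsD(2)[OF assms(1)] assms(2)
  by (auto simp: root_perm_def)

lemma root_perm_id: "root_perm k (\<lambda>w \<in> tree_words k. w) = (\<lambda>a \<in> {..<k}. a)"
  by (auto simp: root_perm_def)

lemma root_perm_compose:
  assumes "f \<in> tree_auts k" "g \<in> tree_auts k"
  shows "root_perm k (compose (tree_words k) f g) = compose {..<k} (root_perm k f) (root_perm k g)"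
proof (rule extensionalityI)
  show "root_perm k (compose (tree_words k) f g) a = compose {..<k} (root_perm k f) (root_perm k g) a"
    if "a \<in> {..<k}" for a
    using that root_perm_singleton[OF assms(2), of a] root_perm_singleton[OF assms(1)]
    by (simp add: compose_def root_perm_def)
qed (auto simp: root_perm_def)

lemma root_perm_Bij:
  assumes f: "f \<in> tree_auts k"
  shows "root_perm k f \<in> Bij {..<k}"
proof -
  have "inj_on (root_perm k f) {..<k}"
  proof (rule inj_onI)
    fix a b
    assume "a \<in> {..<k}" "b \<in> {..<k}" "root_perm k f a = root_perm k f b"
    then show "a = b"
      using root_perm_singleton(1)[OF f] tree_autsD(6)[OF f, of "[a]" "[b]"] by simp
  qed
  moreover have "root_perm k f ` {..<k} \<subseteq> {..<k}"
    using root_perm_singleton(2)[OF f] by auto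
  ultimately have "bij_betw (root_perm k f) {..<k} {..<k}"
    by (simp add: bij_betw_def endo_inj_surj)
  then show ?thesis
    by (simp add: Bij_def root_perm_def)
qed

text \<open>Expresses the local permutation at \<open>u\<close> through the values of
  \<open>f\<close> on words one letter longer than \<open>u\<close>; this locality later yields
  continuity of the coefficients.\<close>

lemma root_perm_section:
  assumes f: "f \<in> tree_auts k" and u: "u \<in> tree_words k"
  shows "root_perm k (tree_section k f u) = (\<lambda>a \<in> {..<k}. last (f (u @ [a])))"
proof -
  have "root_perm k (tree_section k f u) a = last (f (u @ [a]))" if "a < k" for a
    using tree_section_append[OF f u, of "[a]"] that
      root_perm_singleton(1)[OF tree_section_in_tree_auts[OF f u] that] by simp
  then show ?thesis
    by (auto simp: root_perm_def)
qed

section \<open>The iterated wreath product as a group\<close>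

lemma iterated_wreathD:
  assumes "f \<in> iterated_wreath k G"
  shows "f \<in> tree_auts k" "u \<in> tree_words k \<Longrightarrow> root_perm k (tree_section k f u) \<in> G"
  using assms by (auto simp: iterated_wreath_def)

lemma tree_section_in_wreath:
  assumes "f \<in> iterated_wreath k G" "u \<in> tree_words k"
  shows "tree_section k f u \<in> iterated_wreath k G"
  using assms by (auto simp: iterated_wreath_def tree_section_in_tree_auts tree_section_section)

text \<open>By the chain rule the local permutations of a composition are products of local
  permutations of the factors, so closure is inherited from \<open>G\<close>.\<close>

lemma subgroup_iterated_wreath:
  assumes G: "subgroup G (BijGroup {..<k})"
  shows "subgroup (iterated_wreath k G) (BijGroup (tree_words k))"
proof -
  interpret B: group "BijGroup {..<k}" by (rule group_BijGroup)
  interpret T: group "BijGroup (tree_words k)" by (rule group_BijGroup)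
  interpret G: subgroup G "BijGroup {..<k}" by (rule G)
  have mult: "p \<otimes>\<^bsub>BijGroup A\<^esub> q = compose A p q" if "p \<in> Bij A" "q \<in> Bij A"
    for p q :: "'x \<Rightarrow> 'x" and A
    using that by (simp add: BijGroup_def)
  have one: "(\<lambda>x\<in>{..<k}. x) = \<one>\<^bsub>BijGroup {..<k}\<^esub>"
    by (simp add: BijGroup_def)
  show ?thesis
  proof (rule T.subgroupI)
    show "iterated_wreath k G \<subseteq> carrier (BijGroup (tree_words k))"
      by (auto simp: BijGroup_def iterated_wreath_def tree_auts_def)
    have "(\<lambda>w \<in> tree_words k. w) \<in> iterated_wreath k G"
      using G.one_closed
      by (auto simp: iterated_wreath_def id_in_tree_auts tree_section_id root_perm_id one)
    then show "iterated_wreath k G \<noteq> {}"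
      by blast
  next
    fix f
    assume f: "f \<in> iterated_wreath k G"
    note fa = iterated_wreathD(1)[OF f]
    define g where "g = (\<lambda>w \<in> tree_words k. inv_into (tree_words k) f w)"
    have ga: "g \<in> tree_auts k"
      unfolding g_def by (rule inv_in_tree_auts[OF fa])
    have fg: "compose (tree_words k) f g = (\<lambda>w \<in> tree_words k. w)"
      using tree_autsD(3)[OF fa]
      by (auto simp: compose_def g_def bij_betw_inv_into_right restrict_def fun_eq_iff)
    have "root_perm k (tree_section k g u) \<in> G" if u: "u \<in> tree_words k" for u
    \<comment> \<open>The chain rule applied to \<open>f g = id\<close> shows
      \<open>p q = 1\<close>, so the local permutation \<open>q\<close> of the inverse at
      \<open>u\<close> is the inverse of that of \<open>f\<close> at \<open>g u\<close>.\<close>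
    proof -
      define p where "p = root_perm k (tree_section k f (g u))"
      define q where "q = root_perm k (tree_section k g u)"
      have gu: "g u \<in> tree_words k"
        using ga u by (rule tree_autsD(5))
      have p: "p \<in> G"
        unfolding p_def by (rule iterated_wreathD(2)[OF f gu])
      have pB: "p \<in> Bij {..<k}" and qB: "q \<in> Bij {..<k}"
        unfolding p_def q_def
        by (intro root_perm_Bij tree_section_in_tree_auts fa ga u gu)+
      have "p \<otimes>\<^bsub>BijGroup {..<k}\<^esub> q = compose {..<k} p q"
        using pB qB by (rule mult)
      also have "\<dots> = root_perm k (tree_section k (compose (tree_words k) f g) u)"
        unfolding p_def q_def tree_section_compose[OF fa ga u]
        by (intro root_perm_compose[symmetric] tree_section_in_tree_auts fa ga u gu)
      also have "\<dots> = \<one>\<^bsub>BijGroup {..<k}\<^esub>"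
        by (simp add: fg tree_section_id u root_perm_id one)
      finally have "inv\<^bsub>BijGroup {..<k}\<^esub> q = p"
        using pB qB by (intro B.inv_equality) (auto simp: BijGroup_def)
      then have "q = inv\<^bsub>BijGroup {..<k}\<^esub> p"
        using qB by (metis B.inv_inv BijGroup_def partial_object.select_convs(1))
      then show ?thesis
        using p by (simp add: q_def)
    qed
    then show "inv\<^bsub>BijGroup (tree_words k)\<^esub> f \<in> iterated_wreath k G"
      using ga tree_autsD(1)[OF fa] by (simp add: inv_BijGroup iterated_wreath_def g_def)
  next
    fix f g
    assume f: "f \<in> iterated_wreath k G" and g: "g \<in> iterated_wreath k G"
    note fa = iterated_wreathD(1)[OF f] and ga = iterated_wreathD(1)[OF g]
    have "root_perm k (tree_section k (compose (tree_words k) f g) u) \<in> G"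
      if u: "u \<in> tree_words k" for u
    proof -
      have gu: "g u \<in> tree_words k"
        using ga u by (rule tree_autsD(5))
      have "root_perm k (tree_section k (compose (tree_words k) f g) u) =
            compose {..<k} (root_perm k (tree_section k f (g u))) (root_perm k (tree_section k g u))"
        unfolding tree_section_compose[OF fa ga u]
        by (intro root_perm_compose tree_section_in_tree_auts fa ga u gu)
      also have "\<dots> = root_perm k (tree_section k f (g u)) \<otimes>\<^bsub>BijGroup {..<k}\<^esub>
                       root_perm k (tree_section k g u)"
        by (intro mult[symmetric] root_perm_Bij tree_section_in_tree_auts fa ga u gu)
      also have "\<dots> \<in> G"
        using iterated_wreathD(2)[OF f gu] iterated_wreathD(2)[OF g u] by (rule G.m_closed)
      finally show ?thesis .
    qed
    then show "f \<otimes>\<^bsub>BijGroup (tree_words k)\<^esub> g \<in> iterated_wreath k G"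
      using fa ga
      by (simp add: mult tree_autsD(1) iterated_wreath_def compose_in_tree_auts)
  qed
qed

subsection \<open>Portrait series\<close>

locale perm_ab_ring = cring R for R :: "(nat \<Rightarrow> nat) set ring" (structure) +
  fixes k :: nat and G :: "(nat \<Rightarrow> nat) set"
  assumes subgroup_G: "subgroup G (BijGroup {..<k})"
    and add_monoid_R: "add_monoid R = perm_ab k G"
begin

abbreviation coset :: "(nat \<Rightarrow> nat) \<Rightarrow> (nat \<Rightarrow> nat) set" where
  "coset x \<equiv> perm_commutator k G #>\<^bsub>perm_group k G\<^esub> x"

abbreviation wreath_comp :: "(nat list \<Rightarrow> nat list) \<Rightarrow> (nat list \<Rightarrow> nat list) \<Rightarrow> nat list \<Rightarrow> nat list" where
  "wreath_comp \<equiv> compose (tree_words k)"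

lemma carrier_R: "carrier R = carrier (perm_ab k G)"
  using arg_cong[OF add_monoid_R, of carrier] by simp

lemma add_R: "x \<oplus> y = x \<otimes>\<^bsub>perm_ab k G\<^esub> y"
  using arg_cong[OF add_monoid_R, of monoid.mult] by simp

text \<open>Extensionality places \<open>G\<close> inside a finite function space. The finiteness of
  the coefficient ring drives the pigeonhole argument for periodicity.\<close>

lemma finite_carrier_R: "finite (carrier R)"
proof -
  have "G \<subseteq> Bij {..<k}"
    using subgroup.subset[OF subgroup_G] by (simp add: BijGroup_def)
  also have "\<dots> \<subseteq> {..<k} \<rightarrow>\<^sub>E {..<k}"
    by (auto simp: Bij_def PiE_def dest: bij_betw_imp_funcset)
  finally have "finite G"
    by (rule finite_subset) (simp add: finite_PiE)
  then show ?thesis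
    by (simp add: carrier_R perm_ab_def FactGroup_def RCOSETS_def perm_group_def)
qed

lemma coset_hom: "coset \<in> hom (perm_group k G) (perm_ab k G)"
proof -
  have "group (perm_group k G)"
    unfolding perm_group_def by (intro subgroup.subgroup_is_group subgroup_G group_BijGroup)
  then have "perm_commutator k G \<lhd> perm_group k G"
    using group.derived_self_is_normal[of "perm_group k G"]
    by (simp add: perm_commutator_def perm_group_def)
  then show ?thesis
    unfolding perm_ab_def by (rule normal.r_coset_hom_Mod)
qed

lemma coset_closed: "x \<in> G \<Longrightarrow> coset x \<in> carrier R"
  using hom_in_carrier[OF coset_hom, of x] by (simp add: carrier_R perm_group_def)

lemma coset_compose:
  assumes "x \<in> G" "y \<in> G"
  shows "coset (compose {..<k} x y) = coset x \<oplus> coset y"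
proof -
  have "x \<in> Bij {..<k}" "y \<in> Bij {..<k}"
    using assms subgroup.subset[OF subgroup_G] by (auto simp: BijGroup_def)
  then have "compose {..<k} x y = x \<otimes>\<^bsub>perm_group k G\<^esub> y"
    by (simp add: perm_group_def BijGroup_def)
  then show ?thesis
    using hom_mult[OF coset_hom, of x y] assms by (simp add: add_R perm_group_def)
qed

lemma coset_section_closed:
  "g \<in> iterated_wreath k G \<Longrightarrow> u \<in> tree_words k \<Longrightarrow> coset (root_perm k (tree_section k g u)) \<in> carrier R"
  by (intro coset_closed iterated_wreathD)

lemma portrait_series_closed:
  "g \<in> iterated_wreath k G \<Longrightarrow> portrait_series k G R g n \<in> carrier R"
  unfolding portrait_series_def by (intro finsum_closed) (auto intro: coset_section_closed)

text \<open>The chain rule \<open>(gh)\<^sub>w = g\<^bsub>h(w)\<^esub> h\<^sub>w\<close> together with \<open>h\<close> permuting the \<open>n\<close>-th level.\<close>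

lemma portrait_series_compose:
  assumes g: "g \<in> iterated_wreath k G" and h: "h \<in> iterated_wreath k G"
  shows "portrait_series k G R (wreath_comp g h) n =
         portrait_series k G R g n \<oplus> portrait_series k G R h n"
proof -
  note ga = iterated_wreathD(1)[OF g] and ha = iterated_wreathD(1)[OF h]
  let ?L = "{w \<in> tree_words k. length w = n}"
  let ?c = "\<lambda>g w. coset (root_perm k (tree_section k g w))"
  have hL: "h ` ?L \<subseteq> ?L"
    using tree_autsD(5)[OF ha] tree_auts_length[OF ha] by auto
  have inj: "inj_on h ?L"
    using tree_autsD(6)[OF ha] by (auto intro: inj_onI)
  then have img: "h ` ?L = ?L"
    using hL by (intro endo_inj_surj) auto
  have c: "?c (wreath_comp g h) w = ?c g (h w) \<oplus> ?c h w" if w: "w \<in> tree_words k" for w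
  proof -
    have hw: "h w \<in> tree_words k"
      using ha w by (rule tree_autsD(5))
    then show ?thesis
      using iterated_wreathD(2)[OF g hw] iterated_wreathD(2)[OF h w] ga ha w
      by (simp add: tree_section_compose root_perm_compose tree_section_in_tree_auts coset_compose)
  qed
  have gc: "?c g w \<in> carrier R" and hc: "?c h w \<in> carrier R" if "w \<in> tree_words k" for w
    using that g h by (auto intro: coset_section_closed)
  have "portrait_series k G R (wreath_comp g h) n = (\<Oplus>w \<in> ?L. ?c g (h w) \<oplus> ?c h w)"
    unfolding portrait_series_def using c gc hc tree_autsD(5)[OF ha] by (intro finsum_cong') auto
  also have "\<dots> = (\<Oplus>w \<in> ?L. ?c g (h w)) \<oplus> (\<Oplus>w \<in> ?L. ?c h w)"
    using gc hc tree_autsD(5)[OF ha] by (intro finsum_addf) auto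
  also have "(\<Oplus>w \<in> ?L. ?c g (h w)) = (\<Oplus>w \<in> h ` ?L. ?c g w)"
    using gc hL inj by (intro finsum_reindex[symmetric]) auto
  finally show ?thesis
    by (simp add: img portrait_series_def)
qed

section \<open>Coefficients vanish on the closed commutator subgroup\<close>

lemma wreath_group_eq: "wreath_group k G = (BijGroup (tree_words k))\<lparr>carrier := iterated_wreath k G\<rparr>"
  by (simp add: wreath_group_def tree_aut_group_def)

lemma wreath_group_mult:
  assumes "f \<in> tree_auts k" "g \<in> tree_auts k"
  shows "f \<otimes>\<^bsub>wreath_group k G\<^esub> g = wreath_comp f g"
  using assms by (simp add: wreath_group_eq BijGroup_def tree_autsD(1))

lemma group_wreath_group: "group (wreath_group k G)"
  unfolding wreath_group_eq
  by (intro subgroup.subgroup_is_group subgroup_iterated_wreath subgroup_G group_BijGroup)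

lemma portrait_series_hom:
  "(\<lambda>g. portrait_series k G R g n) \<in> hom (wreath_group k G) (add_monoid R)"
proof (rule homI)
  fix g h
  assume "g \<in> carrier (wreath_group k G)" "h \<in> carrier (wreath_group k G)"
  then have gh: "g \<in> iterated_wreath k G" "h \<in> iterated_wreath k G"
    by (simp_all add: wreath_group_def)
  then show "portrait_series k G R (g \<otimes>\<^bsub>wreath_group k G\<^esub> h) n =
      portrait_series k G R g n \<otimes>\<^bsub>add_monoid R\<^esub> portrait_series k G R h n"
    using wreath_group_mult[OF gh[THEN iterated_wreathD(1)]] by (simp add: portrait_series_compose)
qed (simp add: wreath_group_def portrait_series_closed)

text \<open>A homomorphism to an abelian group kills commutators, and its kernel is a subgroup, so
  it contains everything that they generate.\<close>

lemma portrait_series_derived: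
  assumes d: "d \<in> derived (wreath_group k G) (iterated_wreath k G)"
  shows "portrait_series k G R d n = \<zero>"
proof -
  let ?p = "\<lambda>g. portrait_series k G R g n"
  interpret W: group "wreath_group k G" by (rule group_wreath_group)
  interpret p: group_hom "wreath_group k G" "add_monoid R" ?p
    using portrait_series_hom by unfold_locales
  have "derived_set (wreath_group k G) (iterated_wreath k G) \<subseteq> kernel (wreath_group k G) (add_monoid R) ?p"
  proof safe
    fix g h
    assume "g \<in> iterated_wreath k G" "h \<in> iterated_wreath k G"
    then have g: "g \<in> carrier (wreath_group k G)" and h: "h \<in> carrier (wreath_group k G)"
      by (simp_all add: wreath_group_def)
    then have "?p (g \<otimes>\<^bsub>wreath_group k G\<^esub> h \<otimes>\<^bsub>wreath_group k G\<^esub> inv\<^bsub>wreath_group k G\<^esub> g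
                  \<otimes>\<^bsub>wreath_group k G\<^esub> inv\<^bsub>wreath_group k G\<^esub> h) = ?p g \<oplus> ?p h \<oplus> \<ominus> ?p g \<oplus> \<ominus> ?p h"
      by (simp add: a_inv_def p.hom_mult[simplified])
    also have "\<dots> = \<zero>"
      using p.hom_closed[OF g] p.hom_closed[OF h] by simp algebra
    finally show "g \<otimes>\<^bsub>wreath_group k G\<^esub> h \<otimes>\<^bsub>wreath_group k G\<^esub> inv\<^bsub>wreath_group k G\<^esub> g
                  \<otimes>\<^bsub>wreath_group k G\<^esub> inv\<^bsub>wreath_group k G\<^esub> h \<in> kernel (wreath_group k G) (add_monoid R) ?p"
      using g h by (simp add: kernel_def)
  qed
  then have "derived (wreath_group k G) (iterated_wreath k G) \<subseteq> kernel (wreath_group k G) (add_monoid R) ?p"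
    unfolding derived_def by (rule W.generate_subgroup_incl) (rule p.subgroup_kernel)
  then show ?thesis
    using d by (auto simp: kernel_def)
qed

text \<open>Continuity of the coefficients. The level is \<open>Suc n\<close> because the local
  permutation at a word of length \<open>n\<close> acts on the letter that follows.\<close>

lemma portrait_series_cong:
  assumes f: "f \<in> tree_auts k" and g: "g \<in> iterated_wreath k G"
    and eq: "\<And>w. w \<in> tree_words k \<Longrightarrow> length w = Suc n \<Longrightarrow> f w = g w"
  shows "portrait_series k G R f n = portrait_series k G R g n"
proof -
  have "root_perm k (tree_section k f w) = root_perm k (tree_section k g w)"
    if "w \<in> tree_words k" "length w = n" for w
    using f iterated_wreathD(1)[OF g] eq that by (simp add: root_perm_section cong: restrict_cong)
  then show ?thesis
    unfolding portrait_series_def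
    by (intro finsum_cong') (auto intro: coset_section_closed[OF g])
qed

text \<open>A limit point \<open>c\<close> of the derived subgroup agrees with some element
  \<open>d\<close> of it on level \<open>n + 1\<close>, which already determines the
  coefficient.\<close>

lemma portrait_series_commutator:
  assumes c: "c \<in> wreath_commutator k G"
  shows "c \<in> iterated_wreath k G" "portrait_series k G R c n = \<zero>"
proof -
  let ?D = "derived (wreath_group k G) (iterated_wreath k G)"
  show cW: "c \<in> iterated_wreath k G"
    using c by (auto simp: wreath_commutator_def in_closure_of)
  note ca = iterated_wreathD(1)[OF cW]
  \<comment> \<open>A basic open neighbourhood of \<open>c\<close>, whose elements agree with
    \<open>c\<close> on words of length \<open>n + 1\<close>.\<close>
  define U where "U = c <#\<^bsub>tree_aut_group k\<^esub> level_stabilizer k (Suc n)"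
  have mult: "c \<otimes>\<^bsub>tree_aut_group k\<^esub> s = wreath_comp c s" if "s \<in> tree_auts k" for s
    using ca that by (simp add: tree_aut_group_def BijGroup_def tree_autsD(1))
  have "openin (tree_aut_topology k) U"
    unfolding tree_aut_topology_def U_def using ca by (intro topology_generated_by_Basis) auto
  then have "openin (subtopology (tree_aut_topology k) (iterated_wreath k G)) (U \<inter> iterated_wreath k G)"
    by (auto simp: openin_subtopology)
  moreover have "c \<in> U"
  proof -
    have "(\<lambda>w \<in> tree_words k. w) \<in> level_stabilizer k (Suc n)"
      by (simp add: level_stabilizer_def id_in_tree_auts)
    moreover have "c = c \<otimes>\<^bsub>tree_aut_group k\<^esub> (\<lambda>w \<in> tree_words k. w)"
      using tree_autsD(4)[OF ca]
      by (auto simp: mult id_in_tree_auts compose_def extensional_def fun_eq_iff)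
    ultimately show ?thesis
      by (auto simp: U_def l_coset_def)
  qed
  ultimately obtain d where d: "d \<in> ?D" "d \<in> U" "d \<in> iterated_wreath k G"
    using c cW unfolding wreath_commutator_def in_closure_of by blast
  then obtain s where s: "s \<in> level_stabilizer k (Suc n)" "d = wreath_comp c s"
    by (auto simp: U_def l_coset_def mult level_stabilizer_def)
  have "portrait_series k G R c n = portrait_series k G R d n"
    using s by (intro portrait_series_cong ca d(3)) (auto simp: level_stabilizer_def compose_def)
  then show "portrait_series k G R c n = \<zero>"
    using portrait_series_derived[OF d(1)] by simp
qed

text \<open>Ensures that every class contains its representative. Membership in the closure includes
  membership in the space, hence the check that the identity lies in one of the generating
  cosets.\<close>

lemma one_in_wreath_commutator: "\<one>\<^bsub>wreath_group k G\<^esub> \<in> wreath_commutator k G"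
proof -
  interpret W: group "wreath_group k G" by (rule group_wreath_group)
  have "\<one>\<^bsub>wreath_group k G\<^esub> \<in> derived (wreath_group k G) (iterated_wreath k G)"
    unfolding derived_def by (rule generate.one)
  moreover have "\<one>\<^bsub>wreath_group k G\<^esub> \<in> iterated_wreath k G"
    using W.one_closed by (simp add: wreath_group_def)
  moreover have "\<one>\<^bsub>wreath_group k G\<^esub> \<in> topspace (tree_aut_topology k)"
  proof -
    define e where "e = (\<lambda>w \<in> tree_words k. w)"
    have "e \<in> level_stabilizer k 0" "e \<in> tree_auts k"
      by (simp_all add: e_def level_stabilizer_def id_in_tree_auts)
    moreover have "e = e \<otimes>\<^bsub>tree_aut_group k\<^esub> e"
      by (simp add: e_def tree_aut_group_def BijGroup_def id_Bij)
    ultimately have "e \<in> e <#\<^bsub>tree_aut_group k\<^esub> level_stabilizer k 0" "e \<in> tree_auts k"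
      by (auto simp: l_coset_def)
    moreover have "e = \<one>\<^bsub>wreath_group k G\<^esub>"
      by (simp add: e_def wreath_group_eq BijGroup_def)
    ultimately show ?thesis
      unfolding tree_aut_topology_def topology_generated_by_topspace by auto
  qed
  ultimately show ?thesis
    by (auto simp: wreath_commutator_def in_closure_of)
qed

text \<open>Well-definedness: an element of the class is \<open>c f\<close> with \<open>c\<close> in
  the closed commutator subgroup, and \<open>c\<close> contributes zero. The image of the class is
  thus a singleton and \<open>the_elem\<close> returns its element.\<close>

lemma ab_series_wreath_class:
  assumes f: "f \<in> iterated_wreath k G"
  shows "ab_series k G R (wreath_class k G f) = portrait_series k G R f"
proof -
  interpret W: group "wreath_group k G" by (rule group_wreath_group)
  have "portrait_series k G R (c \<otimes>\<^bsub>wreath_group k G\<^esub> f) = portrait_series k G R f"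
    if c: "c \<in> wreath_commutator k G" for c
    using portrait_series_commutator[OF c] f
    by (auto simp: wreath_group_mult iterated_wreathD(1) portrait_series_compose portrait_series_closed)
  moreover have "f \<in> wreath_class k G f"
  proof -
    have "f = \<one>\<^bsub>wreath_group k G\<^esub> \<otimes>\<^bsub>wreath_group k G\<^esub> f"
      using f by (intro W.l_one[symmetric]) (simp add: wreath_group_def)
    then show ?thesis
      using one_in_wreath_commutator by (auto simp: wreath_class_def r_coset_def)
  qed
  ultimately have "portrait_series k G R ` wreath_class k G f = {portrait_series k G R f}"
    by (auto simp: wreath_class_def r_coset_def)
  then show ?thesis
    by (simp add: ab_series_def)
qed

section \<open>Recursion over the first letter, and periodicity\<close>

text \<open>Words of length \<open>n + 1\<close> are grouped by their first letter \<open>a\<close>,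
  and \<open>f_(aw) = (f_a)_w\<close>.\<close>

lemma portrait_series_Suc:
  assumes f: "f \<in> iterated_wreath k G"
  shows "portrait_series k G R f (Suc n) =
         (\<Oplus>a \<in> {..<k}. portrait_series k G R (tree_section k f [a]) n)"
proof -
  note fa = iterated_wreathD(1)[OF f]
  let ?L = "\<lambda>n. {w \<in> tree_words k. length w = n}"
  let ?c = "\<lambda>g w. coset (root_perm k (tree_section k g w))"
  have level: "?L (Suc n) = (\<Union>a \<in> {..<k}. (#) a ` ?L n)"
    by (auto simp: length_Suc_conv)
  have c: "?c f w \<in> carrier R" if "w \<in> tree_words k" for w
    using f that by (rule coset_section_closed)
  have "portrait_series k G R f (Suc n) = (\<Oplus>a \<in> {..<k}. \<Oplus>w \<in> (#) a ` ?L n. ?c f w)"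
    unfolding portrait_series_def level
    by (rule add.finprod_UN_disjoint) (auto simp: pairwise_def disjnt_def intro: c)
  also have "\<dots> = (\<Oplus>a \<in> {..<k}. portrait_series k G R (tree_section k f [a]) n)"
  proof (intro finsum_cong' refl)
    fix a
    assume a: "a \<in> {..<k}"
    have "(\<Oplus>w \<in> (#) a ` ?L n. ?c f w) = (\<Oplus>w \<in> ?L n. ?c f (a # w))"
      using a c by (intro finsum_reindex) auto
    also have "\<dots> = portrait_series k G R (tree_section k f [a]) n"
      unfolding portrait_series_def using a c fa
      by (intro finsum_cong') (auto simp: tree_section_section)
    finally show "(\<Oplus>w \<in> (#) a ` ?L n. ?c f w) = portrait_series k G R (tree_section k f [a]) n" .
  qed (auto intro!: portrait_series_closed tree_section_in_wreath f)
  finally show ?thesis .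
qed

lemma portrait_series_ultimately_periodic:
  assumes f: "f \<in> iterated_wreath k G" and fin: "finite_state k f"
  shows "\<exists>P>0. \<exists>N. \<forall>n\<ge>N. portrait_series k G R f (n + P) = portrait_series k G R f n"
proof -
  note fa = iterated_wreathD(1)[OF f]
  define S where "S = {tree_section k f w | w. w \<in> tree_words k}"
  \<comment> \<open>Restricting to the finite set \<open>S\<close> of states puts every
    \<open>V n\<close> into a finite extensional function space, so two of these vectors
    coincide.\<close>
  define V where "V = (\<lambda>n. \<lambda>s \<in> S. portrait_series k G R s n)"
  have "finite S"
    using fin by (simp add: finite_state_def S_def)
  have SW: "s \<in> iterated_wreath k G" if "s \<in> S" for s
    using that f by (auto simp: S_def tree_section_in_wreath)
  have S_section: "tree_section k s [a] \<in> S" if s: "s \<in> S" and a: "a < k" for s a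
  proof -
    obtain w where w: "w \<in> tree_words k" "s = tree_section k f w"
      using s by (auto simp: S_def)
    then have "tree_section k s [a] = tree_section k f (w @ [a])"
      using fa a by (simp add: tree_section_section)
    then show ?thesis
      using w a by (auto simp: S_def intro!: exI[of _ "w @ [a]"])
  qed
  have fS: "f \<in> S"
    using tree_section_Nil[OF fa] by (auto simp: S_def intro!: exI[of _ "[]"])
  have "range V \<subseteq> S \<rightarrow>\<^sub>E carrier R"
    using SW by (auto simp: V_def portrait_series_closed)
  moreover have "finite (S \<rightarrow>\<^sub>E carrier R)"
    using \<open>finite S\<close> finite_carrier_R by (simp add: finite_PiE)
  ultimately have "finite (range V)"
    by (rule finite_subset)
  then have "\<not> inj V"
    using finite_imageD infinite_UNIV_nat by blast
  then obtain i j where ij: "i < j" "V i = V j"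
    unfolding inj_def by (metis linorder_neqE_nat)
  \<comment> \<open>The recursion computes the next coefficient of a state from current coefficients
    of its one-letter sections, which are states again.\<close>
  have step: "V (Suc m) = V (Suc n)" if "V m = V n" for m n
  proof -
    have eq: "portrait_series k G R s m = portrait_series k G R s n" if "s \<in> S" for s
      using fun_cong[OF \<open>V m = V n\<close>, of s] that by (simp add: V_def)
    have "portrait_series k G R s (Suc m) = portrait_series k G R s (Suc n)" if s: "s \<in> S" for s
      unfolding portrait_series_Suc[OF SW[OF s]]
    proof (intro finsum_cong' refl)
      show "portrait_series k G R (tree_section k s [a]) m =
            portrait_series k G R (tree_section k s [a]) n" if "a \<in> {..<k}" for a
        using that by (intro eq S_section[OF s]) simp
    qed (use S_section[OF s] SW in \<open>auto intro: portrait_series_closed\<close>)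
    then show ?thesis
      by (auto simp: V_def restrict_def fun_eq_iff)
  qed
  have V: "V (i + m) = V (j + m)" for m
  proof (induction m)
    case 0
    show ?case using ij(2) by simp
  next
    case (Suc m)
    from step[OF this] show ?case by simp
  qed
  \<comment> \<open>The period is \<open>j - i\<close> and the preperiod \<open>i\<close>: the
    equality \<open>V (i + m) = V (j + m)\<close> is used with \<open>m = n - i\<close>, and
    \<open>f\<close>, its own section at the root, is one of the states.\<close>
  have "portrait_series k G R f (n + (j - i)) = portrait_series k G R f n" if "i \<le> n" for n
  proof -
    have "V (n + (j - i)) = V n"
      using V[of "n - i"] ij(1) that by (simp add: add.commute)
    from fun_cong[OF this, of f] show ?thesis
      using fS by (simp add: V_def)
  qed
  moreover have "0 < j - i"
    using ij(1) by simp
  ultimately show ?thesis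
    by blast
qed

end

theorem theorem5:
  fixes k :: nat
    and G :: "(nat \<Rightarrow> nat) set"
    and R :: "(nat \<Rightarrow> nat) set ring"
    and f :: "nat list \<Rightarrow> nat list"
  assumes "k \<ge> 1"
    and "transitive_perm_group k G"
    and "cyclic_product_ring_on (perm_ab k G) R"
    and "f \<in> iterated_wreath k G"
    and "finite_state k f"
  shows "rational_series R (ab_series k G R (wreath_class k G f))"
proof -
  interpret perm_ab_ring R k G
  proof (intro perm_ab_ring.intro perm_ab_ring_axioms.intro)
    show "cring R" "add_monoid R = perm_ab k G"
      using assms(3) unfolding cyclic_product_ring_on_def by blast+
    show "subgroup G (BijGroup {..<k})"
      using assms(2) unfolding transitive_perm_group_def by blast
  qed
  obtain P N where P: "0 < P"
    and per: "\<forall>n\<ge>N. portrait_series k G R f (n + P) = portrait_series k G R f n"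
    using portrait_series_ultimately_periodic[OF assms(4,5)] by blast
  have "portrait_series k G R f \<in> UNIV \<rightarrow> carrier R"
    by (rule funcsetI) (rule portrait_series_closed[OF assms(4)])
  then have "rational_series R (portrait_series k G R f)"
    using P per[rule_format] by (rule ultimately_periodic_imp_rational)
  then show ?thesis
    by (simp add: ab_series_wreath_class assms(4))
qed

end
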